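(* Let $\Sigma$ and $\Gamma$ be alphabets and let $w \in \Sigma^+$ be a primitive word. If there exists a letter $a \in \Sigma$ such that $|w|_a = 1$, then $\mathrm{Exp}_{\mathcal I(\Sigma,\Gamma)}(w) = \mathbb Z_+$.
   Context: Alphabets are finite and have at least two letters. $\Sigma^*$ (resp. $\Sigma^+$) is the set of all (resp. all nonempty) words over $\Sigma$; $|w|_a$ is the number of occurrences of the letter $a$ in $w$; $\mathbb Z_+$ is the set of positive integers. A nonempty word is primitive if it is not a power of a shorter word. A morphism $h:\Sigma^*\to\Gamma^*$ is a map with $h(xy)=h(x)h(y)$ for all words $x,y$. $\mathcal I(\Sigma,\Gamma)$ is the family of all injective morphisms $\Sigma^*\to\Gamma^*$. For a family $H$ of morphisms $\Sigma^*\to\Gamma^*$ and $w\in\Sigma^+$, define $\mathrm{Exp}_H(w)=\{n\in\mathbb Z_+ \mid \exists h\in H,\ r\in\Gamma^+ : h(w)=r^n \text{ and } r \text{ is primitive}\}$. *)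

theory Defs
  imports Main "HOL-Library.FuncSet"
begin

text \<open>
  An alphabet is a carrier set of letters. Words over \<open>\<Sigma>\<close> are the members of
  \<^term>\<open>lists \<Sigma>\<close>, concatenation is \<^term>\<open>(@)\<close>, and the number of occurrences of the
  letter \<open>a\<close> in \<open>w\<close> is \<^term>\<open>count_list w a\<close>.
\<close>

definition alphabet :: "'a set \<Rightarrow> bool" where
  "alphabet \<Sigma> \<longleftrightarrow> finite \<Sigma> \<and> 2 \<le> card \<Sigma>"

definition nonempty_words :: "'a set \<Rightarrow> 'a list set" where
  "nonempty_words \<Sigma> = lists \<Sigma> - {[]}"

definition word_power :: "'a list \<Rightarrow> nat \<Rightarrow> 'a list" where
  "word_power u n = concat (replicate n u)"

text \<open>
  The word \<open>u\<close> below need not be restricted to an alphabet: if \<open>w\<close> is nonempty and a power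
  of \<open>u\<close>, then \<open>u\<close> and \<open>w\<close> contain the same letters.
\<close>

definition primitive_word :: "'a list \<Rightarrow> bool" where
  "primitive_word w \<longleftrightarrow> w \<noteq> [] \<and> \<not> (\<exists>u n. length u < length w \<and> w = word_power u n)"

text \<open>
  HOL functions are total, so a morphism on \<open>\<Sigma>\<close> may take arbitrary values outside
  \<^term>\<open>lists \<Sigma>\<close>; all conditions are imposed on \<^term>\<open>lists \<Sigma>\<close> only.
\<close>

definition word_morphism :: "'a set \<Rightarrow> 'b set \<Rightarrow> ('a list \<Rightarrow> 'b list) \<Rightarrow> bool" where
  "word_morphism \<Sigma> \<Gamma> h \<longleftrightarrow>
     h \<in> lists \<Sigma> \<rightarrow> lists \<Gamma> \<and> (\<forall>x\<in>lists \<Sigma>. \<forall>y\<in>lists \<Sigma>. h (x @ y) = h x @ h y)"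

definition injective_morphisms :: "'a set \<Rightarrow> 'b set \<Rightarrow> ('a list \<Rightarrow> 'b list) set" where
  "injective_morphisms \<Sigma> \<Gamma> = {h. word_morphism \<Sigma> \<Gamma> h \<and> inj_on h (lists \<Sigma>)}"

definition Exp :: "'b set \<Rightarrow> ('a list \<Rightarrow> 'b list) set \<Rightarrow> 'a list \<Rightarrow> nat set" where
  "Exp \<Gamma> H w =
     {n. 0 < n \<and> (\<exists>h\<in>H. \<exists>r\<in>nonempty_words \<Gamma>. h w = word_power r n \<and> primitive_word r)}"

end

theory Submission
  imports Defs
begin

text \<open>
  Write \<open>w = u a v\<close> with \<open>a\<close> not in \<open>u v\<close>, and pick distinct letters \<open>0, 1\<close> of \<open>\<Gamma>\<close>. Send the
  letters other than \<open>a\<close> to words of the form \<open>0\<^sup>i 1\<close> with distinct \<open>i > 0\<close>, and let \<open>U, V\<close> be the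
  images of \<open>u, v\<close>. Whatever word \<open>X\<close> starting with \<open>1\<close> is chosen, sending \<open>a\<close> to
  \<open>X (V U X)\<^bsup>n-1\<^esup>\<close> completes a prefix code, so the morphism is injective, and it maps \<open>w\<close> to
  \<open>(U X V)\<^sup>n\<close>. For \<open>X\<close> a suitable power of \<open>1\<close>, the numbers of \<open>0\<close>s and \<open>1\<close>s in \<open>U X V\<close> are
  consecutive, hence coprime, which forces \<open>U X V\<close> to be primitive.
\<close>

lemma count_list_word_power: "count_list (word_power s m) x = m * count_list s x"
  by (induction m) (auto simp: word_power_def)

text \<open>An exponent \<open>m\<close> with \<open>r = word_power s m\<close> divides every letter
  count of \<open>r\<close>, so two coprime counts leave only \<open>m = 1\<close>. Coprimality also
  excludes \<open>r = []\<close>, where both counts are 0.\<close>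

lemma primitive_word_if_coprime_counts:
  assumes "coprime (count_list r x) (count_list r y)"
  shows "primitive_word r"
  unfolding primitive_word_def
proof
  show "r \<noteq> []"
    using assms by auto
  show "\<not> (\<exists>s m. length s < length r \<and> r = word_power s m)"
  proof
    assume "\<exists>s m. length s < length r \<and> r = word_power s m"
    then obtain s m where s: "length s < length r" "r = word_power s m"
      by blast
    then have "m dvd count_list r x" "m dvd count_list r y"
      by (simp_all add: count_list_word_power)
    with assms have "m = 1"
      by (metis coprime_common_divisor_nat)
    with s show False
      by (simp add: word_power_def)
  qed
qed

text \<open>This regrouping collects all but the outer \<open>x\<close> and \<open>z\<close> into
  one block, which can serve as the image of a letter occurring only once.\<close>

lemma word_power_sandwich:
  "word_power (x @ y @ z) (Suc k) = x @ y @ word_power (z @ x @ y) k @ z"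
  by (induction k) (simp_all add: word_power_def)

text \<open>Decoding runs from the left: equal images force equal first letters, whose code words
  cancel.\<close>

lemma inj_on_prefix_code:
  assumes "\<And>b. b \<in> \<Sigma> \<Longrightarrow> c b \<noteq> []"
    and "\<And>b b' p q. b \<in> \<Sigma> \<Longrightarrow> b' \<in> \<Sigma> \<Longrightarrow> c b @ p = c b' @ q \<Longrightarrow> b = b'"
  shows "inj_on (\<lambda>x. concat (map c x)) (lists \<Sigma>)"
proof (rule inj_onI)
  fix x y
  assume "x \<in> lists \<Sigma>" "y \<in> lists \<Sigma>" "concat (map c x) = concat (map c y)"
  then show "x = y"
  proof (induction x arbitrary: y)
    case Nil
    then show ?case
      using assms(1) by (cases y) auto
  next
    case (Cons b x)
    then obtain b' y' where y: "y = b' # y'"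
      using assms(1) by (cases y) auto
    then have "b \<in> \<Sigma>" "b' \<in> \<Sigma>" "c b @ concat (map c x) = c b' @ concat (map c y')"
      using Cons.hyps Cons.prems y by simp_all
    then have "b = b'"
      by (rule assms(2))
    moreover from this have "x = y'"
      using Cons.prems y by (intro Cons.IH) simp_all
    ultimately show ?case
      using y by simp
  qed
qed

lemma injective_morphisms_prefix_code:
  assumes "\<And>b. b \<in> \<Sigma> \<Longrightarrow> c b \<in> lists \<Gamma>"
    and "\<And>b. b \<in> \<Sigma> \<Longrightarrow> c b \<noteq> []"
    and "\<And>b b' p q. b \<in> \<Sigma> \<Longrightarrow> b' \<in> \<Sigma> \<Longrightarrow> c b @ p = c b' @ q \<Longrightarrow> b = b'"
  shows "(\<lambda>x. concat (map c x)) \<in> injective_morphisms \<Sigma> \<Gamma>"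
proof -
  have "set (c b) \<subseteq> \<Gamma>" if "b \<in> \<Sigma>" for b
    using assms(1)[OF that] by auto
  then have "word_morphism \<Sigma> \<Gamma> (\<lambda>x. concat (map c x))"
    unfolding word_morphism_def by (fastforce simp: in_lists_conv_set)
  then show ?thesis
    unfolding injective_morphisms_def using inj_on_prefix_code[OF assms(2,3)] by auto
qed

lemma replicate_append_eq_iff:
  assumes "x \<noteq> y"
  shows "replicate i x @ y # p = replicate j x @ y # q \<longleftrightarrow> i = j \<and> p = q"
proof (induction i arbitrary: j)
  case 0
  then show ?case using assms by (cases j) auto
next
  case (Suc i)
  then show ?case using assms by (cases j) auto
qed

lemma count_list_replicate: "count_list (replicate k x) y = (if x = y then k else 0)"
  by (induction k) auto

theorem theorem4p1:
  fixes \<Sigma> :: "'a set" and \<Gamma> :: "'b set" and w :: "'a list"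
  assumes "alphabet \<Sigma>" and "alphabet \<Gamma>"
    and "w \<in> nonempty_words \<Sigma>" and "primitive_word w"
    and "\<exists>a\<in>\<Sigma>. count_list w a = 1"
  shows "Exp \<Gamma> (injective_morphisms \<Sigma> \<Gamma>) w = {n. 0 < n}"
proof -
  obtain f :: "'a \<Rightarrow> nat" where f: "inj_on f \<Sigma>"
    using assms(1) finite_imp_inj_to_nat_seg unfolding alphabet_def by blast
  have "finite \<Gamma>" "\<not> card \<Gamma> \<le> Suc 0"
    using assms(2) by (simp_all add: alphabet_def)
  then obtain zero one where \<Gamma>: "zero \<in> \<Gamma>" "one \<in> \<Gamma>" "zero \<noteq> one"
    by (auto simp: card_le_Suc0_iff_eq)
  from assms(5) obtain a where a: "a \<in> \<Sigma>" "count_list w a = 1"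
    by blast
  then have "a \<in> set w"
    by (metis count_notin zero_neq_one)
  then obtain u v where w: "w = u @ a # v"
    by (meson split_list)
  with a(2) have uv: "a \<notin> set u" "a \<notin> set v"
    by (simp_all add: count_list_0_iff)

  \<comment> \<open>\<open>Suc\<close> makes each \<open>d b\<close> start with \<open>zero\<close>,
    whereas the image of \<open>a\<close> will start with \<open>one\<close>.\<close>
  define d where "d b = replicate (Suc (f b)) zero @ [one]" for b
  define U where "U = concat (map d u)"
  define V where "V = concat (map d v)"
  have d_lists: "d b \<in> lists \<Gamma>" for b
    using \<Gamma> by (auto simp: d_def)
  then have UV_lists: "set U \<subseteq> \<Gamma>" "set V \<subseteq> \<Gamma>"
    by (auto simp: U_def V_def)
  \<comment> \<open>Each \<open>d b\<close> has exactly one \<open>one\<close> and at least one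
    \<open>zero\<close>.\<close>
  have count_le: "count_list (concat (map d x)) one \<le> count_list (concat (map d x)) zero" for x
    using \<Gamma>(3) by (induction x) (auto simp: d_def count_list_replicate)
  define z where "z = count_list (U @ V) zero"
  \<comment> \<open>By \<open>count_le\<close> this subtraction is not truncated: \<open>j\<close>
    more ones would balance the counts, and the extra one in \<open>X\<close> makes them
    consecutive.\<close>
  define j where "j = z - count_list (U @ V) one"
  define X where "X = replicate (Suc j) one"
  define r where "r = U @ X @ V"
  have "count_list (U @ V) one \<le> z"
    using count_le[of "u @ v"] by (simp add: z_def U_def V_def)
  then have "count_list r zero = z" "count_list r one = Suc z"
    using \<Gamma>(3) by (auto simp: r_def X_def j_def z_def count_list_replicate)
  then have prim: "primitive_word r"
    by (intro primitive_word_if_coprime_counts[of _ zero one]) simp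
  have r_word: "r \<in> nonempty_words \<Gamma>"
    using UV_lists \<Gamma> by (auto simp: r_def X_def nonempty_words_def)

  have "n \<in> Exp \<Gamma> (injective_morphisms \<Sigma> \<Gamma>) w" if "0 < n" for n
  proof -
    obtain k where n: "n = Suc k"
      using \<open>0 < n\<close> by (metis gr0_implies_Suc)
    \<comment> \<open>\<open>Y\<close> is \<open>X @ word_power (V @ U @ X) k\<close> without its
      first \<open>one\<close>, so that the image \<open>one # Y\<close> of \<open>a\<close>
      displays its first letter.\<close>
    define Y where "Y = replicate j one @ word_power (V @ U @ X) k"
    define c where "c = d(a := one # Y)"
    let ?h = "\<lambda>x. concat (map c x)"
    have "set Y \<subseteq> \<Gamma>"
      using UV_lists \<Gamma> by (auto simp: Y_def X_def word_power_def)
    then have c_lists: "c b \<in> lists \<Gamma>" for b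
      using d_lists \<Gamma> by (auto simp: c_def)
    have c_prefix: "b = b'" if "b \<in> \<Sigma>" "b' \<in> \<Sigma>" "c b @ p = c b' @ q" for b b' p q
    proof (cases "b = a \<or> b' = a")
      case True
      then show ?thesis
        using that(3) \<Gamma>(3) by (auto simp: c_def d_def split: if_splits)
    next
      case False
      \<comment> \<open>The first \<open>one\<close> ends the initial run of zeros, so the length of
        that run can be read off.\<close>
      then have "f b = f b'"
        using that(3) replicate_append_eq_iff[OF \<Gamma>(3)] by (simp add: c_def d_def)
      then show ?thesis
        using f that(1,2) by (simp add: inj_on_eq_iff)
    qed
    have "c b \<noteq> []" for b
      by (simp add: c_def d_def)
    then have "?h \<in> injective_morphisms \<Sigma> \<Gamma>"
      by (rule injective_morphisms_prefix_code[OF c_lists _ c_prefix])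
    moreover have "?h w = word_power r n"
    proof -
      have "map c u = map d u" "map c v = map d v"
        using uv by (auto simp: c_def)
      moreover have "c a = X @ word_power (V @ U @ X) k"
        by (simp add: c_def X_def Y_def)
      ultimately have "?h w = U @ X @ word_power (V @ U @ X) k @ V"
        by (simp add: w U_def V_def del: map_eq_conv)
      then show ?thesis
        by (simp only: r_def n word_power_sandwich)
    qed
    ultimately show ?thesis
      unfolding Exp_def using \<open>0 < n\<close> prim r_word
      by (intro CollectI conjI bexI[of _ ?h] bexI[of _ r])
  qed
  then have "{n. 0 < n} \<subseteq> Exp \<Gamma> (injective_morphisms \<Sigma> \<Gamma>) w"
    by blast
  moreover have "Exp \<Gamma> (injective_morphisms \<Sigma> \<Gamma>) w \<subseteq> {n. 0 < n}"
    by (auto simp: Exp_def)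
  ultimately show ?thesis
    by (rule antisym[rotated])
qed

end
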